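(* Let $d\in\{1,2,3,7,11\}$, $K=\mathbb{Q}(\sqrt{-d})$, $\mathcal{O}_d$ its ring of integers, let $\Delta$ be a positive integer which is not of the form $\beta\bar\beta$ with $\beta\in\mathcal{O}_d$, and let $k\ge1$ be an odd integer. Then the series $$H_{k,\Delta}(z)=\sum_{\substack{(a,b,c)\in\mathbb{Z}\times\mathcal{O}_d\times\mathbb{Z}\\ b\bar b-ac=\Delta,\ a<0}}\max\left(0,\left(a|z|^2+bz+\bar b\bar z+c\right)^k\right)$$ converges for every $z\in\mathbb{C}$ and $H_{k,\Delta}$ is a continuous function on $\mathbb{C}$. *)

theory Defs
  imports "HOL-Analysis.Analysis" "HOL-Computational_Algebra.Polynomial"
begin

definition imag_quad_field :: "nat \<Rightarrow> complex set" where
  "imag_quad_field d =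
     {of_real (of_rat x) + of_real (of_rat y) * (\<i> * of_real (sqrt (real d))) | x y. True}"

definition ring_of_integers_iq :: "nat \<Rightarrow> complex set" where
  "ring_of_integers_iq d = {x \<in> imag_quad_field d. algebraic_int x}"

end

theory Submission
  imports Defs
begin

text \<open>
  For \<open>k = 1\<close> the terms with leading coefficient \<open>a\<close> are only bounded by a multiple of
  \<open>1 / \<bar>a\<bar>\<close>, so comparison with a series over \<open>a\<close> fails. Instead the Euclidean algorithm is
  used. The sum \<open>H\<close> is invariant under translation by the ring of integers, and the inversion
  \<open>z \<mapsto> 1 / cnj z\<close>, which swaps \<open>a\<close> and \<open>c\<close>, gives
  \<open>H z = P z + \<bar>z\<bar> ^ (2 * k) * H (1 / cnj z)\<close>, where \<open>P\<close> is a finite sum over the forms with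
  \<open>a < 0 < c\<close>; as \<open>\<Delta>\<close> is not a norm, neither \<open>a\<close> nor \<open>c\<close> vanishes. After a translation
  \<open>\<bar>z\<bar>\<^sup>2 \<le> r < 1\<close>, so the functional equation is contracting: it bounds the finite partial sums
  by a geometric series, and it shows that a bound \<open>E\<close> for the oscillation of \<open>H\<close> at all points
  can be improved to \<open>r * E\<close>, whence \<open>H\<close> is continuous.
\<close>

subsection \<open>Integers of imaginary quadratic fields\<close>

lemma map_poly_of_int_mult:
  "map_poly (of_int :: int \<Rightarrow> 'a :: comm_ring_1) (p * q) = map_poly of_int p * map_poly of_int q"
  by (rule poly_eqI) (simp add: coeff_map_poly coeff_mult)

lemma map_poly_of_int_add:
  "map_poly (of_int :: int \<Rightarrow> 'a :: comm_ring_1) (p + q) = map_poly of_int p + map_poly of_int q"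
  by (rule poly_eqI) (simp add: coeff_map_poly)

text \<open>A non-real \<open>x\<close> is a root of a primitive quadratic integer polynomial \<open>f\<close>. By Gauss's lemma
  \<open>f\<close> divides every monic integer polynomial vanishing at \<open>x\<close>, so its leading coefficient
  is a unit.\<close>

lemma algebraic_int_trace_norm:
  assumes x: "algebraic_int x" and tr: "2 * Re x \<in> \<rat>" and nm: "(cmod x)\<^sup>2 \<in> \<rat>"
  shows "2 * Re x \<in> \<int> \<and> (cmod x)\<^sup>2 \<in> \<int>"
proof (cases "Im x = 0")
  case True
  \<comment> \<open>A real \<open>x\<close> is half its trace, hence rational, and a rational
    algebraic integer is an integer.\<close>
  have "2 * Re x / 2 \<in> \<rat>"
    using tr by (rule Rats_divide) simp
  then have "Re x \<in> \<rat>" by simp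
  moreover have eq: "x = of_real (Re x)"
    using True by (simp add: complex_eq_iff)
  then have "algebraic_int (Re x)"
    by (metis algebraic_int_of_real_iff x)
  ultimately have "Re x \<in> \<int>"
    using rational_algebraic_int_is_int by blast
  then show ?thesis
    using True by (simp add: cmod_power2)
next
  case False
  obtain p where p: "poly (map_poly of_int p) x = 0" "lead_coeff p = 1"
    using x by (auto simp: algebraic_int_altdef_ipoly)
  obtain t1 t2 where t: "t2 > 0" "2 * Re x = of_int t1 / of_int t2"
    using tr by (auto elim!: Rats_cases')
  obtain n1 n2 where n: "n2 > 0" "(cmod x)\<^sup>2 = of_int n1 / of_int n2"
    using nm by (auto elim!: Rats_cases')
  \<comment> \<open>The characteristic polynomial X^2 - (t1/t2) X + n1/n2 of \<open>x\<close>, with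
    denominators cleared.\<close>
  define g :: "int poly" where "g = [:n1 * t2, - (t1 * n2), t2 * n2:]"
  define f where "f = primitive_part g"
  have gn: "g \<noteq> 0" using t n by (simp add: g_def)
  have deg_g: "degree g = 2" using t n by (simp add: g_def)
  have deg_f: "degree f = 2" by (simp add: f_def deg_g)
  have fn: "f \<noteq> 0" using deg_f by auto
  have cf: "content f = 1" using gn by (simp add: f_def)
  define A B C where "A = coeff f 2" and "B = coeff f 1" and "C = coeff f 0"
  have A0: "A \<noteq> 0" using deg_f fn unfolding A_def by (metis leading_coeff_0_iff)
  have gf: "g = smult (content g) f" by (simp add: f_def)
  have cg: "content g \<noteq> 0" using gn by simp
  have "coeff g 0 = content g * C" "coeff g 1 = content g * B" "coeff g 2 = content g * A"
    by (subst gf, simp add: A_def B_def C_def)+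
  then have co: "n1 * t2 = content g * C" "- (t1 * n2) = content g * B" "t2 * n2 = content g * A"
    by (auto simp: g_def numeral_2_eq_2)
  have "of_int A * (2 * Re x) = - real_of_int B"
  proof -
    have "real_of_int (content g) * (of_int A * (2 * Re x)) = of_int (content g * A) * (of_int t1 / of_int t2)"
      by (simp add: t)
    also have "\<dots> = of_int (t1 * n2)"
      unfolding co(3)[symmetric] using t by simp
    also have "\<dots> = real_of_int (content g) * (- real_of_int B)"
      using co(2) by (metis mult_minus_right of_int_minus of_int_mult minus_minus)
    finally show ?thesis using cg by (simp only: mult_cancel_left) simp
  qed
  note trA = this
  have "of_int A * (cmod x)\<^sup>2 = real_of_int C"
  proof -
    have "real_of_int (content g) * (of_int A * (cmod x)\<^sup>2) = of_int (content g * A) * (of_int n1 / of_int n2)"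
      by (simp add: n)
    also have "\<dots> = of_int (n1 * t2)"
      unfolding co(3)[symmetric] using n by simp
    also have "\<dots> = real_of_int (content g) * real_of_int C"
      unfolding co(1) by simp
    finally show ?thesis using cg by (simp only: mult_cancel_left) simp
  qed
  note nmA = this
  have f_eq: "f = [:C, B, A:]"
  proof (rule poly_eqI)
    fix i show "coeff f i = coeff [:C, B, A:] i"
    proof (cases "i \<le> 2")
      case True
      then have "i = 0 \<or> i = 1 \<or> i = 2" by auto
      then show ?thesis by (auto simp: A_def B_def C_def numeral_2_eq_2)
    next
      case False
      then have "coeff f i = 0" by (intro coeff_eq_0) (simp add: deg_f)
      moreover have "coeff [:C, B, A:] i = 0" using False
        by (intro coeff_eq_0) (auto intro: le_less_trans[OF degree_pCons_le])
      ultimately show ?thesis by simp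
    qed
  qed
  have x2: "x^2 = complex_of_real (2 * Re x) * x - complex_of_real ((cmod x)\<^sup>2)"
    by (simp only: cmod_power2) (simp add: complex_eq_iff power2_eq_square algebra_simps)
  have "poly (map_poly of_int f) x = of_int A * x^2 + of_int B * x + of_int C"
    by (simp add: f_eq map_poly_pCons power2_eq_square algebra_simps)
  also have "\<dots> = of_real (of_int A * (2 * Re x) + of_int B) * x + of_real (of_int C - of_int A * (cmod x)\<^sup>2)"
    by (simp only: x2) (simp add: algebra_simps)
  finally have fx: "poly (map_poly of_int f) x = 0"
    unfolding trA nmA by simp
  \<comment> \<open>Division by \<open>f\<close> inside the integer polynomials costs a power of its
    leading coefficient \<open>A\<close>. The remainder \<open>s\<close> is at most linear and
    vanishes at the non-real \<open>x\<close>, so it is zero.\<close>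
  obtain q s where qs: "pseudo_divmod p f = (q, s)" by fastforce
  define e where "e = Suc (degree p) - degree f"
  have pd: "smult (A ^ e) p = f * q + s" "s = 0 \<or> degree s < degree f"
    using pseudo_divmod[OF fn qs] by (simp_all add: e_def A_def deg_f)
  have "map_poly complex_of_int (smult (A ^ e) p) = map_poly of_int (f * q + s)"
    using pd by simp
  then have "smult (of_int (A ^ e)) (map_poly of_int p)
      = map_poly complex_of_int f * map_poly of_int q + map_poly of_int s"
    by (simp add: map_poly_of_int_add map_poly_of_int_mult map_poly_smult)
  then have "poly (smult (of_int (A ^ e)) (map_poly of_int p)) x
      = poly (map_poly complex_of_int f * map_poly of_int q + map_poly of_int s) x"
    by simp
  then have sx: "poly (map_poly of_int s) x = 0"
    by (simp add: p fx)
  have "degree s \<le> 1" using pd(2) deg_f by auto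
  then have s_eq: "s = [:coeff s 0, coeff s 1:]"
    by (intro poly_eqI) (auto simp: coeff_pCons coeff_eq_0 split: nat.splits)
  have "poly (map_poly of_int s) x = of_int (coeff s 0) + x * of_int (coeff s 1)"
    by (subst s_eq) (simp add: map_poly_pCons)
  with sx have "Re (of_int (coeff s 0) + x * of_int (coeff s 1)) = 0"
    "Im (of_int (coeff s 0) + x * of_int (coeff s 1)) = 0"
    by simp_all
  then have "s = 0" using False s_eq by auto
  with pd have fq: "smult (A ^ e) p = f * q" by simp
  \<comment> \<open>Gauss's lemma: since \<open>f\<close> is primitive, \<open>q\<close> has content
    \<open>\<bar>A ^ e\<bar>\<close>, so the factor \<open>A ^ e\<close> cancels and
    \<open>f\<close> divides the monic \<open>p\<close>.\<close>
  have "content p dvd 1"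
    using content_dvd_coeff[of p "degree p"] p(2) by simp
  then have "content p = 1"
    by (simp only: is_unit_content_iff)
  then have "content q = \<bar>A ^ e\<bar>"
    using arg_cong[OF fq, of content] cf by (simp add: content_mult)
  then have "[:A ^ e:] dvd q"
    by (simp add: const_poly_dvd_iff_dvd_content)
  then obtain q' where q': "q = smult (A ^ e) q'"
    by (auto elim!: dvdE)
  have "p = f * q'"
    using fq A0 unfolding q' mult_smult_right by (simp add: poly_eq_iff)
  then have "A * lead_coeff q' = 1"
    using p(2) by (metis A_def deg_f lead_coeff_mult)
  then have "A dvd 1" by (metis dvd_triv_left)
  then consider "A = 1" | "A = -1" unfolding zdvd1_eq by linarith
  then show ?thesis
  proof cases
    case 1
    then have "2 * Re x = of_int (- B)" "(cmod x)\<^sup>2 = of_int C" using trA nmA by simp_all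
    then show ?thesis by (simp only: Ints_of_int)
  next
    case 2
    then have "2 * Re x = of_int B" "(cmod x)\<^sup>2 = of_int (- C)" using trA nmA by simp_all
    then show ?thesis by (simp only: Ints_of_int)
  qed
qed


lemma Rats_squarefree_mult_square:
  fixes q :: real
  assumes d: "d \<in> {1, 2, 3, 7, 11 :: nat}" and q: "q \<in> \<rat>" and "real d * q\<^sup>2 \<in> \<int>"
  shows "q \<in> \<int>"
proof -
  obtain m n where mn: "n > 0" "coprime m n" "q = of_int m / of_int n"
    using q by (rule Rats_cases')
  obtain N where "real d * q\<^sup>2 = of_int N"
    using assms(3) by (auto elim: Ints_cases)
  then have "real d * (of_int m)\<^sup>2 = of_int N * (of_int n)\<^sup>2"
    using mn by (simp add: field_simps)
  then have "real_of_int (int d * m\<^sup>2) = real_of_int (N * n\<^sup>2)"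
    by simp
  then have "int d * m\<^sup>2 = N * n\<^sup>2"
    by (simp only: of_int_eq_iff)
  then have "n\<^sup>2 dvd int d * m\<^sup>2" by simp
  moreover have "coprime (n\<^sup>2) (m\<^sup>2)" using mn by (simp add: coprime_commute)
  ultimately have dv: "n\<^sup>2 dvd int d" by (simp add: coprime_dvd_mult_left_iff)
  have "n\<^sup>2 \<le> int d" using dv d by (intro zdvd_imp_le) auto
  also have "\<dots> < 4\<^sup>2" using d by auto
  finally have "n < 4" by (rule power_less_imp_less_base) simp
  with mn(1) have "n = 1 \<or> n = 2 \<or> n = 3" by auto
  with dv d have "n = 1" by auto
  with mn show ?thesis by simp
qed

text \<open>Here \<open>s\<close> is the trace of \<open>b\<close> and (s^2 + d t^2)/4 its norm. The
  single congruence treats all \<open>d\<close> alike: for \<open>d = 1, 2\<close> it forces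
  \<open>s\<close> and \<open>t\<close> to be even, for the other \<open>d\<close> only to have
  equal parity.\<close>

lemma ring_of_integers_iq_iff:
  assumes d: "d \<in> {1, 2, 3, 7, 11}"
  shows "b \<in> ring_of_integers_iq d \<longleftrightarrow>
    (\<exists>s t :: int. 4 dvd s\<^sup>2 + int d * t\<^sup>2 \<and> b = Complex (of_int s / 2) (of_int t * sqrt d / 2))"
proof
  assume "b \<in> ring_of_integers_iq d"
  then obtain x y where b: "b = of_real (of_rat x) + of_real (of_rat y) * (\<i> * of_real (sqrt (real d)))"
    and ai: "algebraic_int b"
    by (auto simp: ring_of_integers_iq_def imag_quad_field_def)
  have re: "Re b = of_rat x" and im: "Im b = of_rat y * sqrt d"
    by (simp_all add: b)
  have nm: "(cmod b)\<^sup>2 = (of_rat x)\<^sup>2 + d * (of_rat y)\<^sup>2"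
    by (simp add: cmod_power2 re im power_mult_distrib)
  have "2 * Re b \<in> \<int> \<and> (cmod b)\<^sup>2 \<in> \<int>"
    by (rule algebraic_int_trace_norm[OF ai]) (simp_all add: re nm)
  then obtain s N where s: "2 * Re b = of_int s" and N: "(cmod b)\<^sup>2 = of_int N"
    by (auto elim!: Ints_cases)
  have x2: "of_rat x = real_of_int s / 2" using s re by simp
  have dy: "real d * (2 * of_rat y)\<^sup>2 = of_int (4 * N - s\<^sup>2)"
    using nm unfolding N x2 by (simp add: power2_eq_square field_simps)
  have "real d * (2 * of_rat y)\<^sup>2 \<in> \<int>"
    unfolding dy by (rule Ints_of_int)
  then have "2 * of_rat y \<in> (\<int> :: real set)"
    by (rule Rats_squarefree_mult_square[OF d, rotated]) simp
  then obtain t where t: "2 * of_rat y = real_of_int t"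
    by (auto elim: Ints_cases)
  have "real_of_int (int d * t\<^sup>2) = of_int (4 * N - s\<^sup>2)"
    using dy unfolding t by simp
  then have "int d * t\<^sup>2 = 4 * N - s\<^sup>2"
    by (simp only: of_int_eq_iff)
  then have "s\<^sup>2 + int d * t\<^sup>2 = 4 * N" by simp
  moreover have "b = Complex (of_int s / 2) (of_int t * sqrt d / 2)"
    using t by (simp add: complex_eq_iff re im x2)
  ultimately show "\<exists>s t :: int. 4 dvd s\<^sup>2 + int d * t\<^sup>2 \<and> b = Complex (of_int s / 2) (of_int t * sqrt d / 2)"
    by (metis dvd_triv_left)
next
  assume "\<exists>s t :: int. 4 dvd s\<^sup>2 + int d * t\<^sup>2 \<and> b = Complex (of_int s / 2) (of_int t * sqrt d / 2)"
  then obtain s t :: int where st: "4 dvd s\<^sup>2 + int d * t\<^sup>2"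
    and b: "b = Complex (of_int s / 2) (of_int t * sqrt d / 2)" by blast
  obtain N where N: "s\<^sup>2 + int d * t\<^sup>2 = 4 * N" using st by blast
  have "b = of_real (of_rat (of_int s / 2)) + of_real (of_rat (of_int t / 2)) * (\<i> * of_real (sqrt (real d)))"
    by (simp add: b complex_eq_iff of_rat_divide)
  then have "b \<in> imag_quad_field d"
    unfolding imag_quad_field_def by blast
  moreover have "algebraic_int b"
  proof (rule algebraic_int.intros[of "[:of_int N, - of_int s, 1:]"])
    show "lead_coeff [:of_int N, - of_int s, 1 :: complex:] = 1" by simp
    show "\<forall>i. coeff [:of_int N, - of_int s, 1 :: complex:] i \<in> \<int>"
      by (auto simp: coeff_pCons split: nat.splits)
    have "real_of_int (s\<^sup>2 + int d * t\<^sup>2) = 4 * of_int N"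
      by (subst N) simp
    then have "(of_int s)\<^sup>2 + real d * (of_int t)\<^sup>2 = 4 * of_int N"
      by simp
    then show "poly [:of_int N, - of_int s, 1:] b = 0"
      by (simp add: b complex_eq_iff power2_eq_square field_simps)
  qed
  ultimately show "b \<in> ring_of_integers_iq d"
    by (simp add: ring_of_integers_iq_def)
qed

subsection \<open>Sums of Hermitian forms over a norm-Euclidean ring\<close>

text \<open>The properties of the ring of integers that drive the argument. Trace, norm and closure
  conditions let translations by \<open>R\<close> act on integral forms, \<open>euclidean\<close>
  with \<open>r < 1\<close> gives the contraction, and \<open>not_norm\<close> excludes vanishing
  outer coefficients.\<close>

locale norm_euclidean_forms =
  fixes R :: "complex set" and \<Delta> :: int and r :: real and k :: nat
  assumes trace_mult_Ints: "b \<in> R \<Longrightarrow> l \<in> R \<Longrightarrow> 2 * Re (b * l) \<in> \<int>"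
    and norm_Ints: "b \<in> R \<Longrightarrow> (cmod b)\<^sup>2 \<in> \<int>"
    and one_closed: "1 \<in> R"
    and uminus_closed: "b \<in> R \<Longrightarrow> - b \<in> R"
    and add_mult_cnj_closed: "b \<in> R \<Longrightarrow> l \<in> R \<Longrightarrow> b + of_int a * cnj l \<in> R"
    and euclidean: "\<exists>l\<in>R. (cmod (z - l))\<^sup>2 \<le> r"
    and r_bounds: "0 < r" "r < 1"
    and Delta_pos: "0 < \<Delta>"
    and not_norm: "b \<in> R \<Longrightarrow> (cmod b)\<^sup>2 \<noteq> of_int \<Delta>"
    and odd_k: "odd k"
begin

definition forms :: "(int \<times> complex \<times> int) set" where
  "forms = {(a, b, c). b \<in> R \<and> (cmod b)\<^sup>2 - of_int a * of_int c = of_int \<Delta>}"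

definition neg_forms :: "(int \<times> complex \<times> int) set" where
  "neg_forms = {t \<in> forms. fst t < 0}"

text \<open>Every form in \<open>forms\<close> is indefinite, because a c - |b|^2 = -\<Delta> < 0.
  The names of this set and the next refer only to the signs of the outer coefficients.\<close>

definition indef_forms :: "(int \<times> complex \<times> int) set" where
  "indef_forms = {t \<in> forms. fst t < 0 \<and> 0 < snd (snd t)}"

definition neg_def_forms :: "(int \<times> complex \<times> int) set" where
  "neg_def_forms = {t \<in> forms. fst t < 0 \<and> snd (snd t) < 0}"

fun form_val :: "complex \<Rightarrow> int \<times> complex \<times> int \<Rightarrow> real" where
  "form_val z (a, b, c) = of_int a * (cmod z)\<^sup>2 + 2 * Re (b * z) + of_int c"

text \<open>Substitution of \<open>z + l\<close> for \<open>z\<close>. The new constant coefficient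
  is the value at \<open>l\<close>, an integer when \<open>b\<close> and \<open>l\<close> lie in
  \<open>R\<close>; the floor merely makes it an \<open>int\<close>.\<close>

fun form_shift :: "complex \<Rightarrow> int \<times> complex \<times> int \<Rightarrow> int \<times> complex \<times> int" where
  "form_shift l (a, b, c) =
    (a, b + of_int a * cnj l, \<lfloor>of_int a * (cmod l)\<^sup>2 + 2 * Re (b * l) + of_int c\<rfloor>)"

fun form_flip :: "int \<times> complex \<times> int \<Rightarrow> int \<times> complex \<times> int" where
  "form_flip (a, b, c) = (c, b, a)"

section \<open>Translation, inversion and finiteness properties of forms\<close>

lemma form_shift_coeff:
  assumes "b \<in> R" "l \<in> R"
  shows "real_of_int \<lfloor>of_int a * (cmod l)\<^sup>2 + 2 * Re (b * l) + of_int c\<rfloor>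
    = of_int a * (cmod l)\<^sup>2 + 2 * Re (b * l) + of_int c"
proof -
  have "of_int a * (cmod l)\<^sup>2 + 2 * Re (b * l) + of_int c \<in> \<int>"
    by (rule Ints_add[OF Ints_add[OF Ints_mult[OF Ints_of_int norm_Ints[OF assms(2)]]
          trace_mult_Ints[OF assms]] Ints_of_int])
  then show ?thesis by (rule of_int_floor)
qed

lemma form_shift_val:
  assumes "t \<in> forms" "l \<in> R"
  shows "form_val z (form_shift l t) = form_val (z + l) t"
proof -
  obtain a b c where t: "t = (a, b, c)" by (cases t)
  have b: "b \<in> R" using assms by (auto simp: forms_def t)
  show ?thesis
    unfolding t form_shift.simps form_val.simps form_shift_coeff[OF b assms(2)]
    by (simp only: cmod_power2) (simp add: power2_eq_square algebra_simps)
qed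

lemma form_shift_forms:
  assumes "t \<in> forms" "l \<in> R"
  shows "form_shift l t \<in> forms"
proof -
  obtain a b c where t: "t = (a, b, c)" by (cases t)
  have b: "b \<in> R" and e: "(cmod b)\<^sup>2 - of_int a * of_int c = of_int \<Delta>"
    using assms by (auto simp: forms_def t)
  have "(cmod (b + of_int a * cnj l))\<^sup>2
      - of_int a * of_int \<lfloor>of_int a * (cmod l)\<^sup>2 + 2 * Re (b * l) + of_int c\<rfloor>
    = (cmod b)\<^sup>2 - of_int a * of_int c"
    unfolding form_shift_coeff[OF b assms(2)]
    by (simp only: cmod_power2) (simp add: power2_eq_square algebra_simps)
  then show ?thesis
    using e add_mult_cnj_closed[OF b assms(2)] by (simp add: forms_def t)
qed

lemma fst_form_shift [simp]: "fst (form_shift l t) = fst t"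
  by (cases t) simp

lemma form_shift_neg_forms: "t \<in> neg_forms \<Longrightarrow> l \<in> R \<Longrightarrow> form_shift l t \<in> neg_forms"
  by (simp add: neg_forms_def form_shift_forms)

text \<open>Computing with floors is avoided: the first two coefficients cancel directly, and the
  last one is the value at 0.\<close>

lemma form_shift_cancel:
  assumes "t \<in> forms" "l \<in> R"
  shows "form_shift (- l) (form_shift l t) = t"
proof -
  obtain a b c where t: "t = (a, b, c)" by (cases t)
  have l: "- l \<in> R" using assms uminus_closed by simp
  obtain c' where c': "form_shift (- l) (form_shift l t) = (a, b, c')"
    by (simp add: t)
  have "form_val 0 (a, b, c') = form_val 0 t"
    unfolding c'[symmetric] using assms l by (simp add: form_shift_val form_shift_forms)
  then show ?thesis unfolding c' by (simp add: t)
qed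

lemma bij_betw_form_shift:
  assumes l: "l \<in> R"
  shows "bij_betw (form_shift l) neg_forms neg_forms"
proof (rule bij_betw_byWitness[where f' = "form_shift (- l)"])
  have f: "neg_forms \<subseteq> forms" by (auto simp: neg_forms_def)
  show "\<forall>t\<in>neg_forms. form_shift (- l) (form_shift l t) = t"
    using f l form_shift_cancel by blast
  show "\<forall>t\<in>neg_forms. form_shift l (form_shift (- l) t) = t"
    using f l form_shift_cancel[of _ "- l"] uminus_closed by auto
  show "form_shift l ` neg_forms \<subseteq> neg_forms" "form_shift (- l) ` neg_forms \<subseteq> neg_forms"
    using l uminus_closed form_shift_neg_forms by blast+
qed

lemma form_flip_flip [simp]: "form_flip (form_flip t) = t"
  by (cases t) simp

text \<open>The point 1 / \<open>cnj z\<close> becomes \<open>z\<close> after multiplication by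
  |z|^2, so the middle term is preserved while the outer two are exchanged.\<close>

lemma form_flip_val:
  assumes "z \<noteq> 0"
  shows "(cmod z)\<^sup>2 * form_val (inverse (cnj z)) t = form_val z (form_flip t)"
proof -
  obtain a b c where t: "t = (a, b, c)" by (cases t)
  have nz: "(cmod z)\<^sup>2 \<noteq> 0" using assms by simp
  have 1: "(cmod z)\<^sup>2 * (cmod (inverse (cnj z)))\<^sup>2 = 1"
    using nz by (simp add: norm_inverse power_inverse)
  have "of_real ((cmod z)\<^sup>2) * inverse (cnj z) = z"
    using assms by (simp add: complex_norm_square del: of_real_power)
  then have "of_real ((cmod z)\<^sup>2) * (b * inverse (cnj z)) = b * z"
    by (simp add: mult.left_commute)
  then have 2: "(cmod z)\<^sup>2 * Re (b * inverse (cnj z)) = Re (b * z)"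
    by (metis Re_complex_of_real mult.commute times_complex.sel(1) Im_complex_of_real mult_zero_right diff_zero)
  have "(cmod z)\<^sup>2 * form_val (inverse (cnj z)) t
      = of_int a * ((cmod z)\<^sup>2 * (cmod (inverse (cnj z)))\<^sup>2)
        + 2 * ((cmod z)\<^sup>2 * Re (b * inverse (cnj z))) + of_int c * (cmod z)\<^sup>2"
    by (simp add: t algebra_simps)
  then show ?thesis
    unfolding 1 2 by (simp add: t)
qed

lemma forms_nonzero:
  assumes "(a, b, c) \<in> forms"
  shows "a \<noteq> 0" "c \<noteq> 0"
  using assms not_norm by (auto simp: forms_def)

lemma neg_forms_split:
  "neg_forms = indef_forms \<union> neg_def_forms" "indef_forms \<inter> neg_def_forms = {}"
  using forms_nonzero by (force simp: neg_forms_def indef_forms_def neg_def_forms_def)+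

lemma form_flip_neg_def: "t \<in> neg_def_forms \<Longrightarrow> form_flip t \<in> neg_def_forms"
  by (cases t rule: prod_cases3) (auto simp: neg_def_forms_def forms_def algebra_simps)

lemma bij_betw_form_flip: "bij_betw form_flip neg_def_forms neg_def_forms"
  by (rule bij_betw_byWitness[where f' = form_flip]) (use form_flip_neg_def in \<open>auto simp del: form_flip.simps\<close>)

text \<open>Completing the square gives a f(z) + \<Delta> = |a z + \<open>cnj b\<close>|^2, so a
  form has maximum \<Delta> / |a|, and |a| is at least 1.\<close>

lemma form_val_le:
  assumes "t \<in> neg_forms"
  shows "form_val z t \<le> of_int \<Delta>"
proof (cases "form_val z t \<le> 0")
  case True
  then show ?thesis using Delta_pos by simp
next
  case False
  obtain a b c where t: "t = (a, b, c)" by (cases t)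
  have a: "a < 0" and e: "(cmod b)\<^sup>2 - of_int a * of_int c = of_int \<Delta>"
    using assms by (auto simp: neg_forms_def forms_def t)
  have "of_int a * form_val z t + of_int \<Delta> = (cmod (of_int a * z + cnj b))\<^sup>2"
    unfolding e[symmetric] t form_val.simps
    by (simp only: cmod_power2) (simp add: power2_eq_square algebra_simps)
  then have "- of_int a * form_val z t \<le> of_int \<Delta>"
    by (smt (verit) mult_minus_left zero_le_power2)
  moreover have "1 * form_val z t \<le> - of_int a * form_val z t"
    using False a by (intro mult_right_mono) auto
  ultimately show ?thesis by simp
qed

text \<open>An element is determined by its trace \<open>s\<close>, its norm \<open>N\<close> and
  the sign of its imaginary part. The trace is bounded by |s| <= s^2 <= 4 N.\<close>

lemma finite_norm_le: "finite {b \<in> R. (cmod b)\<^sup>2 \<le> of_int \<Delta>}"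
proof (rule finite_subset)
  define g where "g = (\<lambda>(s :: int, N :: int, e :: real).
    Complex (of_int s / 2) (e * sqrt (of_int N - (of_int s / 2)\<^sup>2)))"
  show "finite (g ` ({-(4 * \<Delta>)..4 * \<Delta>} \<times> {0..\<Delta>} \<times> {-1, 1}))" by auto
  show "{b \<in> R. (cmod b)\<^sup>2 \<le> of_int \<Delta>} \<subseteq> g ` ({-(4 * \<Delta>)..4 * \<Delta>} \<times> {0..\<Delta>} \<times> {-1, 1})"
  proof
    fix b assume "b \<in> {b \<in> R. (cmod b)\<^sup>2 \<le> of_int \<Delta>}"
    then have b: "b \<in> R" "(cmod b)\<^sup>2 \<le> of_int \<Delta>" by auto
    obtain s where s: "2 * Re b = of_int s"
      using trace_mult_Ints[OF b(1) one_closed] by (auto elim: Ints_cases)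
    obtain N where N: "(cmod b)\<^sup>2 = of_int N"
      using norm_Ints[OF b(1)] by (auto elim: Ints_cases)
    have "real_of_int (s\<^sup>2) \<le> of_int (4 * N)"
      using s[symmetric] N[symmetric] by (simp add: cmod_power2 power_mult_distrib)
    then have s2: "s\<^sup>2 \<le> 4 * N" by (simp only: of_int_le_iff)
    have "\<bar>s\<bar> \<le> s\<^sup>2"
      using mult_left_mono[of 1 "\<bar>s\<bar>" "\<bar>s\<bar>"] by (cases "s = 0") (simp_all add: power2_eq_square)
    have N0: "0 \<le> N" "N \<le> \<Delta>"
      using N b by (metis of_int_0_le_iff zero_le_power2, simp)
    have ss: "s \<in> {-(4 * \<Delta>)..4 * \<Delta>}" using s2 N0 \<open>\<bar>s\<bar> \<le> s\<^sup>2\<close> by auto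
    have re: "Re b = of_int s / 2" using s by simp
    have "of_int N - (of_int s / 2)\<^sup>2 = (Im b)\<^sup>2"
      using N unfolding cmod_power2 re by simp
    then have "sqrt (of_int N - (of_int s / 2)\<^sup>2) = \<bar>Im b\<bar>" by simp
    then have "b = g (s, N, if Im b < 0 then -1 else 1)"
      by (simp add: g_def complex_eq_iff re)
    then show "b \<in> g ` ({-(4 * \<Delta>)..4 * \<Delta>} \<times> {0..\<Delta>} \<times> {-1, 1})"
      using ss N0 by (intro image_eqI) auto
  qed
qed

text \<open>For a < 0 < c the equation reads \<Delta> = |b|^2 + |a| c with non-negative terms, which
  bounds all three coefficients.\<close>

lemma finite_indef_forms: "finite indef_forms"
proof (rule finite_subset)
  show "finite ({-\<Delta>..0} \<times> {b \<in> R. (cmod b)\<^sup>2 \<le> of_int \<Delta>} \<times> {0..\<Delta>})"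
    using finite_norm_le by auto
  show "indef_forms \<subseteq> {-\<Delta>..0} \<times> {b \<in> R. (cmod b)\<^sup>2 \<le> of_int \<Delta>} \<times> {0..\<Delta>}"
  proof
    fix t assume t: "t \<in> indef_forms"
    obtain a b c where abc: "t = (a, b, c)" by (cases t)
    have h: "b \<in> R" "(cmod b)\<^sup>2 - of_int a * of_int c = of_int \<Delta>" "a < 0" "0 < c"
      using t by (auto simp: indef_forms_def forms_def abc)
    have "real_of_int ((- a) * c) \<le> of_int \<Delta>"
      using h(2) by (smt (verit) mult_minus_left of_int_minus of_int_mult zero_le_power2)
    then have ac: "(- a) * c \<le> \<Delta>" by (simp only: of_int_le_iff)
    have "- a * 1 \<le> - a * c" "1 * c \<le> - a * c"
      using h by (intro mult_left_mono mult_right_mono; simp)+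
    moreover have "real_of_int a * of_int c \<le> 0" using h by (simp add: mult_nonpos_nonneg)
    ultimately have "- a \<le> \<Delta>" "c \<le> \<Delta>" "(cmod b)\<^sup>2 \<le> of_int \<Delta>"
      using h(2) ac by linarith+
    then show "t \<in> {-\<Delta>..0} \<times> {b \<in> R. (cmod b)\<^sup>2 \<le> of_int \<Delta>} \<times> {0..\<Delta>}"
      using h by (auto simp: abc)
  qed
qed


section \<open>Uniform bound for the partial sums\<close>

definition form_term :: "complex \<Rightarrow> int \<times> complex \<times> int \<Rightarrow> real" where
  "form_term z t = max 0 (form_val z t ^ k)"

definition form_sum :: "complex \<Rightarrow> real" where
  "form_sum z = (\<Sum>\<^sub>\<infinity>t\<in>neg_forms. form_term z t)"

text \<open>The limit of the geometric series: the solution B of B = M + r B, where M bounds the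
  contribution of \<open>indef_forms\<close>.\<close>

definition sum_bound :: real where
  "sum_bound = real (card indef_forms) * of_int \<Delta> ^ k / (1 - r)"

text \<open>The correction term \<open>P\<close> of the functional equation. Inverting the whole sum
  also yields the flips of \<open>indef_forms\<close>, which have positive leading coefficient; they
  are subtracted.\<close>

definition indef_sum :: "complex \<Rightarrow> real" where
  "indef_sum z = (\<Sum>t\<in>indef_forms. form_term z t - form_term z (form_flip t))"

lemma k_pos: "0 < k"
  using odd_k by (cases k) auto

lemma form_term_nonneg: "0 \<le> form_term z t"
  by (simp add: form_term_def)

text \<open>Oddness of \<open>k\<close> enters here: powers of negative values stay negative and are
  cut off by the maximum.\<close>

lemma form_term_eq_0: "form_val z t \<le> 0 \<Longrightarrow> form_term z t = 0"
  using odd_k k_pos by (cases "form_val z t = 0") (auto simp: form_term_def power_le_zero_eq)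

lemma form_term_pos: "0 \<le> form_val z t \<Longrightarrow> form_term z t = form_val z t ^ k"
  by (simp add: form_term_def)

lemma form_term_flip:
  assumes "z \<noteq> 0"
  shows "(cmod z) ^ (2 * k) * form_term (inverse (cnj z)) t = form_term z (form_flip t)"
proof -
  have "form_term z (form_flip t) = max 0 (((cmod z)\<^sup>2 * form_val (inverse (cnj z)) t) ^ k)"
    by (simp add: form_term_def form_flip_val[OF assms])
  also have "\<dots> = max ((cmod z) ^ (2 * k) * 0) ((cmod z) ^ (2 * k) * form_val (inverse (cnj z)) t ^ k)"
    by (simp add: power_mult_distrib power_mult)
  also have "\<dots> = (cmod z) ^ (2 * k) * form_term (inverse (cnj z)) t"
    by (simp add: form_term_def max_mult_distrib_left)
  finally show ?thesis by simp
qed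

lemma sum_bound_fixpoint: "real (card indef_forms) * of_int \<Delta> ^ k + r * sum_bound = sum_bound"
proof -
  have "(1 - r) * sum_bound = real (card indef_forms) * of_int \<Delta> ^ k"
    using r_bounds by (simp add: sum_bound_def)
  then show ?thesis by (simp add: algebra_simps)
qed

lemma sum_bound_nonneg: "0 \<le> sum_bound"
  using r_bounds Delta_pos by (simp add: sum_bound_def)

lemma norm_power_le:
  assumes "(cmod z)\<^sup>2 \<le> r"
  shows "(cmod z) ^ (2 * k) \<le> r"
proof -
  have "(cmod z) ^ (2 * k) = ((cmod z)\<^sup>2) ^ k" by (simp add: power_mult)
  also have "\<dots> \<le> r ^ k" using assms by (intro power_mono) auto
  also have "\<dots> \<le> r ^ 1" using r_bounds k_pos by (intro power_decreasing) auto
  finally show ?thesis by simp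
qed

text \<open>Each translation followed by an inversion multiplies the value of a form by at least \<open>1 / r\<close>,
  while no value exceeds \<open>\<Delta>\<close>; so the induction on \<open>n\<close> counts the remaining steps.\<close>

lemma sum_le_sum_bound_aux:
  assumes "finite U" "U \<subseteq> neg_forms" "\<And>t. t \<in> U \<Longrightarrow> (of_int \<Delta> + 1) * r ^ n \<le> form_val z t"
  shows "(\<Sum>t\<in>U. form_term z t) \<le> sum_bound"
  using assms
proof (induction n arbitrary: z U)
  case 0
  \<comment> \<open>For \<open>n = 0\<close> the assumed lower bound is \<Delta> + 1, above the
    maximum of every form.\<close>
  have "U = {}"
    using "0.prems" form_val_le[of _ z] by force
  then show ?case using sum_bound_nonneg by simp
next
  case (Suc n)
  obtain l where l: "l \<in> R" "(cmod (z - l))\<^sup>2 \<le> r" using euclidean by blast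
  define y where "y = z - l"
  define V where "V = form_shift l ` U"
  have zl: "(cmod y)\<^sup>2 \<le> r" using l by (simp add: y_def)
  have Uf: "U \<subseteq> forms" using Suc.prems by (auto simp: neg_forms_def)
  have val: "form_val y (form_shift l t) = form_val z t" if "t \<in> U" for t
    using that Uf l by (auto simp: form_shift_val y_def)
  have inj: "inj_on (form_shift l) U"
    using bij_betw_form_shift[OF l(1)] Suc.prems(2) by (meson bij_betw_imp_inj_on inj_on_subset)
  have Vn: "V \<subseteq> neg_forms"
    using bij_betw_form_shift[OF l(1)] Suc.prems(2) by (auto simp: V_def bij_betw_def)
  have finV: "finite V" using Suc.prems by (simp add: V_def)
  have Vv: "(of_int \<Delta> + 1) * r ^ Suc n \<le> form_val y t" if "t \<in> V" for t
    using that Suc.prems(3) val unfolding V_def by (metis imageE)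
  have sumV: "(\<Sum>t\<in>U. form_term z t) = (\<Sum>t\<in>V. form_term y t)"
    unfolding V_def by (subst sum.reindex[OF inj]) (auto intro!: sum.cong simp: form_term_def val)
  have low: "0 < (of_int \<Delta> + 1) * r ^ Suc n" using Delta_pos r_bounds by simp
  have vpos: "0 < form_val y t" if "t \<in> V" for t
    using Vv[OF that] low by linarith
  have "(\<Sum>t\<in>V \<inter> indef_forms. form_term y t) \<le> (\<Sum>t\<in>V \<inter> indef_forms. of_int \<Delta> ^ k)"
  proof (rule sum_mono)
    fix t assume "t \<in> V \<inter> indef_forms"
    then show "form_term y t \<le> of_int \<Delta> ^ k"
      using vpos[of t] form_val_le[of t y] Vn form_term_pos[of y t] power_mono[of "form_val y t" "of_int \<Delta>" k]
      by auto
  qed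
  also have "\<dots> = real (card (V \<inter> indef_forms)) * of_int \<Delta> ^ k" by simp
  also have "\<dots> \<le> real (card indef_forms) * of_int \<Delta> ^ k"
    using finite_indef_forms Delta_pos by (intro mult_right_mono) (auto intro: card_mono)
  finally have A: "(\<Sum>t\<in>V \<inter> indef_forms. form_term y t) \<le> real (card indef_forms) * of_int \<Delta> ^ k" .
  have B: "(\<Sum>t\<in>V \<inter> neg_def_forms. form_term y t) \<le> r * sum_bound"
  proof (cases "y = 0")
    case True
    \<comment> \<open>No inversion is available at \<open>y = 0\<close>, but there the value is the
      last coefficient, which is negative.\<close>
    have "V \<inter> neg_def_forms = {}"
    proof (rule ccontr)
      assume "V \<inter> neg_def_forms \<noteq> {}"
      then obtain t where t: "t \<in> V" "t \<in> neg_def_forms" by blast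
      have "form_val y t \<le> 0" using t(2) True by (cases t) (auto simp: neg_def_forms_def)
      with vpos[OF t(1)] show False by simp
    qed
    then show ?thesis using sum_bound_nonneg r_bounds by simp
  next
    case False
    define x where "x = inverse (cnj y)"
    define W where "W = form_flip ` (V \<inter> neg_def_forms)"
    have "finite W" using finV by (simp add: W_def)
    moreover have "W \<subseteq> neg_forms"
      using form_flip_neg_def neg_forms_split(1) by (auto simp: W_def)
    \<comment> \<open>Values at \<open>x\<close> are those at \<open>y\<close> divided by |y|^2 <=
      r, so the lower bound gains a factor 1 / r and the induction hypothesis applies.\<close>
    moreover have "(of_int \<Delta> + 1) * r ^ n \<le> form_val x t" if tW: "t \<in> W" for t
    proof -
      obtain u where u: "u \<in> V" "t = form_flip u" using tW unfolding W_def by blast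
      have y0: "0 < (cmod y)\<^sup>2" using False by simp
      have e: "(cmod y)\<^sup>2 * form_val x t = form_val y u"
        using form_flip_val[OF False, of t] u by (simp add: x_def)
      then have "0 < (cmod y)\<^sup>2 * form_val x t" using vpos u by simp
      then have "0 < form_val x t" using y0 zero_less_mult_pos by blast
      have "r * ((of_int \<Delta> + 1) * r ^ n) \<le> form_val y u" using Vv[OF u(1)] by (simp add: mult_ac)
      also have "\<dots> \<le> r * form_val x t"
        unfolding e[symmetric] using zl \<open>0 < form_val x t\<close> by (intro mult_right_mono) auto
      finally show ?thesis using r_bounds by simp
    qed
    ultimately have W: "(\<Sum>t\<in>W. form_term x t) \<le> sum_bound"
      by (rule Suc.IH)
    have "(\<Sum>t\<in>V \<inter> neg_def_forms. form_term y t) = (\<Sum>t\<in>W. form_term y (form_flip t))"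
      unfolding W_def by (subst sum.reindex) (auto intro: inj_onI dest: arg_cong[of _ _ form_flip])
    also have "\<dots> = (cmod y) ^ (2 * k) * (\<Sum>t\<in>W. form_term x t)"
      by (simp add: sum_distrib_left x_def form_term_flip[OF False])
    also have "\<dots> \<le> r * sum_bound"
      using W norm_power_le[OF zl] r_bounds by (intro mult_mono) (auto intro: sum_nonneg form_term_nonneg)
    finally show ?thesis .
  qed
  have "V = (V \<inter> indef_forms) \<union> (V \<inter> neg_def_forms)"
    using Vn neg_forms_split(1) by auto
  moreover have "(V \<inter> indef_forms) \<inter> (V \<inter> neg_def_forms) = {}"
    using neg_forms_split(2) by auto
  ultimately have "(\<Sum>t\<in>V. form_term y t)
      = (\<Sum>t\<in>V \<inter> indef_forms. form_term y t) + (\<Sum>t\<in>V \<inter> neg_def_forms. form_term y t)"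
    using finV by (metis finite_Int sum.union_disjoint)
  then show ?case
    using A B sum_bound_fixpoint sumV by linarith
qed

text \<open>Only positive values contribute, and for a finite set some
  \<open>(\<Delta> + 1) * r ^ n\<close> lies below all of them. The bound is independent of
  \<open>U\<close>, \<open>z\<close> and \<open>n\<close>, hence yields both summability and
  boundedness of \<open>form_sum\<close>.\<close>

lemma sum_le_sum_bound:
  assumes "finite U" "U \<subseteq> neg_forms"
  shows "(\<Sum>t\<in>U. form_term z t) \<le> sum_bound"
proof -
  define V where "V = {t \<in> U. 0 < form_val z t}"
  have finV: "finite V" using assms by (simp add: V_def)
  have "\<exists>n. \<forall>t\<in>V. (of_int \<Delta> + 1) * r ^ n \<le> form_val z t"
  proof -
    have "\<forall>\<^sub>F n in sequentially. \<forall>t\<in>V. (of_int \<Delta> + 1) * r ^ n \<le> form_val z t"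
    proof (rule eventually_ball_finite[OF finV], rule ballI)
      fix t assume "t \<in> V"
      have "(\<lambda>n. (of_int \<Delta> + 1) * r ^ n) \<longlonglongrightarrow> (of_int \<Delta> + 1) * 0"
        using r_bounds by (intro tendsto_mult_left LIMSEQ_power_zero) simp
      then have "\<forall>\<^sub>F n in sequentially. (of_int \<Delta> + 1) * r ^ n < form_val z t"
        using \<open>t \<in> V\<close> by (intro order_tendstoD(2)) (auto simp: V_def)
      then show "\<forall>\<^sub>F n in sequentially. (of_int \<Delta> + 1) * r ^ n \<le> form_val z t"
        by (rule eventually_mono) simp
    qed
    then show ?thesis by (auto simp: eventually_sequentially)
  qed
  then obtain n where n: "\<And>t. t \<in> V \<Longrightarrow> (of_int \<Delta> + 1) * r ^ n \<le> form_val z t" by blast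
  have "(\<Sum>t\<in>U. form_term z t) = (\<Sum>t\<in>V. form_term z t)"
    using assms(1) by (intro sum.mono_neutral_right) (auto simp: V_def intro: form_term_eq_0)
  also have "\<dots> \<le> sum_bound"
    using finV assms(2) n by (intro sum_le_sum_bound_aux) (auto simp: V_def)
  finally show ?thesis .
qed

lemma summable_form_term: "form_term z summable_on neg_forms"
  by (intro nonneg_bdd_above_summable_on bdd_aboveI[where M = sum_bound])
    (auto intro: form_term_nonneg sum_le_sum_bound)

lemma form_sum_bounds: "0 \<le> form_sum z" "form_sum z \<le> sum_bound"
  unfolding form_sum_def
  by (auto intro!: infsum_nonneg form_term_nonneg infsum_le_finite_sums summable_form_term sum_le_sum_bound)

section \<open>Periodicity and functional equation\<close>

lemma form_sum_shift:
  assumes "l \<in> R"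
  shows "form_sum (z + l) = form_sum z"
proof -
  have "form_sum z = (\<Sum>\<^sub>\<infinity>t\<in>neg_forms. form_term z (form_shift l t))"
    unfolding form_sum_def by (rule infsum_reindex_bij_betw[OF bij_betw_form_shift[OF assms], symmetric])
  also have "\<dots> = form_sum (z + l)"
    unfolding form_sum_def using assms
    by (intro infsum_cong) (auto simp: form_term_def form_shift_val neg_forms_def)
  finally show ?thesis by simp
qed

lemma infsum_neg_forms:
  assumes "f summable_on neg_forms"
  shows "(\<Sum>\<^sub>\<infinity>t\<in>neg_forms. f t) = (\<Sum>t\<in>indef_forms. f t) + (\<Sum>\<^sub>\<infinity>t\<in>neg_def_forms. f t :: real)"
proof -
  have "f summable_on neg_def_forms"
    using assms neg_forms_split(1) by (intro summable_on_subset_banach[OF assms]) auto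
  then show ?thesis
    unfolding neg_forms_split(1) using finite_indef_forms neg_forms_split(2)
    by (subst infsum_Un_disjoint) (auto intro: summable_on_finite)
qed

text \<open>The flip permutes \<open>neg_def_forms\<close>, so both sides have the same sum over
  that set; the difference is the finite sum over \<open>indef_forms\<close>.\<close>

lemma form_sum_functional_equation:
  "form_sum z = indef_sum z + (cmod z) ^ (2 * k) * form_sum (inverse (cnj z))"
proof -
  have F: "form_sum z = (\<Sum>t\<in>indef_forms. form_term z t) + (\<Sum>\<^sub>\<infinity>t\<in>neg_def_forms. form_term z t)"
    unfolding form_sum_def by (rule infsum_neg_forms[OF summable_form_term])
  show ?thesis
  proof (cases "z = 0")
    case True
    \<comment> \<open>At 0 the factor of the inverted sum vanishes, and a form takes its last
      coefficient as value, so only \<open>indef_forms\<close> contributes.\<close>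
    have "(\<Sum>\<^sub>\<infinity>t\<in>neg_def_forms. form_term z t) = 0"
      using True by (intro infsum_0 form_term_eq_0) (auto simp: neg_def_forms_def)
    moreover have "(\<Sum>t\<in>indef_forms. form_term z (form_flip t)) = 0"
      using True by (intro sum.neutral ballI form_term_eq_0) (auto simp: indef_forms_def)
    ultimately show ?thesis
      using F k_pos True by (simp add: indef_sum_def sum_subtractf)
  next
    case False
    have sm: "(\<lambda>t. form_term z (form_flip t)) summable_on neg_forms"
      unfolding form_term_flip[OF False, symmetric] by (intro summable_on_cmult_right summable_form_term)
    have "(cmod z) ^ (2 * k) * form_sum (inverse (cnj z)) = (\<Sum>\<^sub>\<infinity>t\<in>neg_forms. form_term z (form_flip t))"
      unfolding form_term_flip[OF False, symmetric] form_sum_def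
      by (rule infsum_cmult_right'[symmetric])
    also have "\<dots> = (\<Sum>t\<in>indef_forms. form_term z (form_flip t))
        + (\<Sum>\<^sub>\<infinity>t\<in>neg_def_forms. form_term z (form_flip t))"
      by (rule infsum_neg_forms[OF sm])
    also have "(\<Sum>\<^sub>\<infinity>t\<in>neg_def_forms. form_term z (form_flip t)) = (\<Sum>\<^sub>\<infinity>t\<in>neg_def_forms. form_term z t)"
      by (rule infsum_reindex_bij_betw[OF bij_betw_form_flip])
    finally show ?thesis
      using F by (simp add: indef_sum_def sum_subtractf)
  qed
qed

section \<open>Continuity by contraction of the oscillation\<close>

lemma continuous_form_term: "continuous_on UNIV (\<lambda>z. form_term z t)"
  unfolding form_term_def by (cases t) (auto intro!: continuous_intros)

lemma continuous_indef_sum: "continuous_on UNIV indef_sum"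
  unfolding indef_sum_def by (intro continuous_intros continuous_form_term)

text \<open>In the functional equation near a point with |y|^2 <= r, \<open>indef_sum\<close> and
  the factor of the bounded function \<open>form_sum\<close> are continuous. What remains is that
  factor, at most \<open>r\<close>, times the oscillation at 1 / \<open>cnj y\<close>; hence the
  bound \<open>E\<close> is assumed at all points.\<close>

lemma form_sum_oscillation_step:
  assumes E: "\<And>z e. E < e \<Longrightarrow> \<forall>\<^sub>F w in nhds z. \<bar>form_sum w - form_sum z\<bar> < e"
    and E0: "0 \<le> E" and e: "r * E < e"
  shows "\<forall>\<^sub>F w in nhds z. \<bar>form_sum w - form_sum z\<bar> < e"
proof -
  obtain l where l: "l \<in> R" "(cmod (z - l))\<^sup>2 \<le> r" using euclidean by blast
  define y where "y = z - l"
  have yr: "(cmod y)\<^sup>2 \<le> r" using l by (simp add: y_def)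
  have "E < e / r" using e r_bounds by (simp add: field_simps)
  then obtain e' where e': "E < e'" "e' < e / r" using dense by blast
  then have re: "r * e' < e" using r_bounds by (simp add: field_simps)
  \<comment> \<open>\<open>G\<close> collects the contributions that vanish at \<open>y\<close>;
    they have to fit into the slack \<open>e - r * e'\<close>.\<close>
  define G where "G w = \<bar>indef_sum w - indef_sum y\<bar> + \<bar>(cmod w) ^ (2 * k) - (cmod y) ^ (2 * k)\<bar> * sum_bound" for w
  have "continuous_on UNIV G"
    unfolding G_def by (intro continuous_intros continuous_indef_sum)
  then have "isCont G y" by (simp add: continuous_on_eq_continuous_at)
  then have lim: "(G \<longlongrightarrow> G y) (nhds y)"
    by (simp add: continuous_at_imp_continuous_at_within isCont_def tendsto_at_iff_tendsto_nhds)
  have "G y < e - r * e'" using re by (simp add: G_def)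
  then have G: "\<forall>\<^sub>F w in nhds y. G w < e - r * e'"
    by (rule order_tendstoD(2)[OF lim])
  have third: "\<forall>\<^sub>F w in nhds y. (cmod y) ^ (2 * k) *
      \<bar>form_sum (inverse (cnj w)) - form_sum (inverse (cnj y))\<bar> \<le> r * e'"
  proof (cases "y = 0")
    \<comment> \<open>The inversion is not continuous at 0, but its coefficient is zero
      there.\<close>
    case True
    moreover have "0 \<le> r * e'" using E0 e' r_bounds by simp
    ultimately show ?thesis using k_pos by (simp add: power_0_left)
  next
    case False
    have "isCont (\<lambda>w. inverse (cnj w)) y"
      using False by (intro continuous_intros) auto
    then have "((\<lambda>w. inverse (cnj w)) \<longlongrightarrow> inverse (cnj y)) (nhds y)"
      unfolding isCont_def by (subst (asm) tendsto_at_iff_tendsto_nhds)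
    then have "\<forall>\<^sub>F w in nhds y. \<bar>form_sum (inverse (cnj w)) - form_sum (inverse (cnj y))\<bar> < e'"
      by (rule eventually_compose_filterlim[OF E[OF e'(1)]])
    then show ?thesis
      by (rule eventually_mono)
        (use norm_power_le[OF yr] r_bounds in \<open>intro mult_mono; simp\<close>)
  qed
  have Y: "\<forall>\<^sub>F w in nhds y. \<bar>form_sum w - form_sum y\<bar> < e"
    using G third
  proof eventually_elim
    case (elim w)
    let ?i = "\<lambda>w. form_sum (inverse (cnj w))"
    have "form_sum w - form_sum y = (indef_sum w - indef_sum y)
        + ((cmod w) ^ (2 * k) - (cmod y) ^ (2 * k)) * ?i w + (cmod y) ^ (2 * k) * (?i w - ?i y)"
      unfolding form_sum_functional_equation[of w] form_sum_functional_equation[of y]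
      by (simp add: algebra_simps)
    then have "\<bar>form_sum w - form_sum y\<bar> \<le> \<bar>indef_sum w - indef_sum y\<bar>
        + \<bar>((cmod w) ^ (2 * k) - (cmod y) ^ (2 * k)) * ?i w\<bar> + \<bar>(cmod y) ^ (2 * k) * (?i w - ?i y)\<bar>"
      by linarith
    also have "\<bar>((cmod w) ^ (2 * k) - (cmod y) ^ (2 * k)) * ?i w\<bar>
        \<le> \<bar>(cmod w) ^ (2 * k) - (cmod y) ^ (2 * k)\<bar> * sum_bound"
      unfolding abs_mult using form_sum_bounds by (intro mult_left_mono) auto
    also have "\<bar>(cmod y) ^ (2 * k) * (?i w - ?i y)\<bar> \<le> r * e'"
      using elim(2) by (simp add: abs_mult)
    finally show ?case using elim(1) unfolding G_def by linarith
  qed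
  have "((\<lambda>w. w - l) \<longlongrightarrow> y) (nhds z)"
    unfolding y_def by (rule tendsto_diff[OF filterlim_ident tendsto_const])
  then have "\<forall>\<^sub>F w in nhds z. \<bar>form_sum (w - l) - form_sum y\<bar> < e"
    by (rule eventually_compose_filterlim[OF Y])
  moreover have "form_sum (w - l) = form_sum w" for w
    using form_sum_shift[OF l(1), of "w - l"] by simp
  ultimately show ?thesis by (simp add: y_def)
qed

lemma form_sum_oscillation:
  "sum_bound * r ^ n < e \<Longrightarrow> \<forall>\<^sub>F w in nhds z. \<bar>form_sum w - form_sum z\<bar> < e"
proof (induction n arbitrary: z e)
  case 0
  \<comment> \<open>All values lie between 0 and \<open>sum_bound\<close>, so two of them differ by
    at most \<open>sum_bound\<close>.\<close>
  have "\<bar>form_sum w - form_sum z\<bar> < e" for w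
    using form_sum_bounds[of w] form_sum_bounds[of z] 0 by simp
  then show ?case by simp
next
  case (Suc n)
  show ?case
    by (rule form_sum_oscillation_step[where E = "sum_bound * r ^ n"])
      (use Suc sum_bound_nonneg r_bounds in \<open>auto simp: mult_ac\<close>)
qed

lemma continuous_form_sum: "continuous_on UNIV form_sum"
proof -
  have "(form_sum \<longlongrightarrow> form_sum z) (nhds z)" for z
  proof (rule tendstoI)
    fix e :: real assume e: "0 < e"
    have "(\<lambda>n. sum_bound * r ^ n) \<longlonglongrightarrow> sum_bound * 0"
      using r_bounds by (intro tendsto_mult_left LIMSEQ_power_zero) simp
    then have "\<forall>\<^sub>F n in sequentially. sum_bound * r ^ n < e"
      using e by (intro order_tendstoD(2)) auto
    then obtain n where "sum_bound * r ^ n < e"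
      by (auto simp: eventually_sequentially)
    then show "\<forall>\<^sub>F w in nhds z. dist (form_sum w) (form_sum z) < e"
      unfolding dist_real_def by (rule form_sum_oscillation)
  qed
  then show ?thesis
    by (simp add: continuous_on_eq_continuous_at isCont_def tendsto_at_iff_tendsto_nhds)
qed

end

subsection \<open>The norm-Euclidean rings of integers\<close>

text \<open>The expression is twice the trace of a product of two integers of the field. Each
  hypothesis gives s = d t modulo 2, so the expression is d (d - 1) t t' modulo 2.\<close>

lemma dvd_4_imp_even:
  fixes s t s' t' :: int
  assumes "4 dvd s\<^sup>2 + int d * t\<^sup>2" "4 dvd s'\<^sup>2 + int d * t'\<^sup>2"
  shows "even (s * s' - int d * (t * t'))"
proof -
  have "even (s\<^sup>2 + int d * t\<^sup>2)" "even (s'\<^sup>2 + int d * t'\<^sup>2)"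
    using assms by (meson dvd_trans even_numeral)+
  then have "even s \<longleftrightarrow> even d \<or> even t" "even s' \<longleftrightarrow> even d \<or> even t'"
    by simp_all
  then show ?thesis by auto
qed

text \<open>Rounding leaves at most 1/4 from the real part and d/4 (for d <= 2) or d/16 from the
  imaginary part. The worst case is d = 11 with 1/4 + 11/16 = 15/16.\<close>

lemma norm_euclidean_ring_of_integers_iq:
  assumes d: "d \<in> {1, 2, 3, 7, 11}"
  shows "\<exists>l\<in>ring_of_integers_iq d. (cmod (z - l))\<^sup>2 \<le> 15 / 16"
proof -
  have rd: "\<bar>x - of_int (round x)\<bar> \<le> 1 / 2" for x :: real
    using of_int_round_abs_le[of x] by (simp add: abs_minus_commute)
  \<comment> \<open>For \<open>d \<equiv> 3 (mod 4)\<close> the imaginary parts of integers are the multiples of \<open>sqrt d / 2\<close>, so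
    the imaginary part is rounded first and the real part is then rounded with matching parity.\<close>
  define q where "q = (if d \<le> 2 then 1 else 2 :: int)"
  define m where "m = round (q * Im z / sqrt d)"
  define u where "u = (if d \<le> 2 then 0 else m)"
  define n where "n = round (Re z - u / 2)"
  define s where "s = 2 * n + u"
  define t where "t = (if d \<le> 2 then 2 * m else m)"
  define l where "l = Complex (of_int s / 2) (of_int t * sqrt d / 2)"
  have "s\<^sup>2 + int d * t\<^sup>2 = (if d \<le> 2 then 4 * (n\<^sup>2 + int d * m\<^sup>2) else 4 * (n\<^sup>2 + n * m) + (1 + int d) * m\<^sup>2)"
    by (simp add: s_def t_def u_def power2_eq_square algebra_simps)
  moreover have "\<not> d \<le> 2 \<Longrightarrow> 4 dvd 1 + int d"
    using d by auto
  ultimately have "4 dvd s\<^sup>2 + int d * t\<^sup>2"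
    by simp
  then have "l \<in> ring_of_integers_iq d"
    using ring_of_integers_iq_iff[OF d] unfolding l_def by blast
  moreover have "(cmod (z - l))\<^sup>2 \<le> 15 / 16"
  proof -
    have sd: "0 < sqrt d" using d by auto
    have "Re z - Re l = (Re z - u / 2) - of_int (round (Re z - u / 2))"
      unfolding n_def[symmetric] by (simp add: l_def s_def field_simps)
    then have "\<bar>Re z - Re l\<bar> \<le> 1 / 2" using rd[of "Re z - u / 2"] by (simp only:)
    then have 1: "(Re z - Re l)\<^sup>2 \<le> (1 / 2)\<^sup>2" by (metis abs_le_square_iff abs_of_nonneg zero_le_divide_1_iff zero_le_numeral)
    have "of_int q * (Im z - Im l) = sqrt d * (q * Im z / sqrt d - of_int m)"
      using sd by (simp add: l_def t_def q_def field_simps)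
    then have "(of_int q * (Im z - Im l))\<^sup>2 = d * (q * Im z / sqrt d - of_int m)\<^sup>2"
      by (simp add: power_mult_distrib)
    also have "\<dots> \<le> d * (1 / 2)\<^sup>2"
      using rd[of "q * Im z / sqrt d"] unfolding m_def
      by (intro mult_left_mono) (metis abs_le_square_iff abs_of_nonneg zero_le_divide_1_iff zero_le_numeral, simp)
    finally have "(of_int q)\<^sup>2 * (Im z - Im l)\<^sup>2 \<le> d / 4"
      unfolding power_mult_distrib by (simp add: power_divide)
    then have "(Im z - Im l)\<^sup>2 \<le> 11 / 16"
      using d by (auto simp: q_def)
    with 1 show ?thesis unfolding cmod_power2 by (simp add: power_divide)
  qed
  ultimately show ?thesis by blast
qed

lemma norm_euclidean_forms_ring_of_integers_iq:
  fixes \<Delta> :: int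
  assumes d: "d \<in> {1, 2, 3, 7, 11}" and "\<Delta> > 0"
    and nn: "\<not> (\<exists>\<beta>\<in>ring_of_integers_iq d. \<beta> * cnj \<beta> = of_int \<Delta>)" and "odd k"
  shows "norm_euclidean_forms (ring_of_integers_iq d) \<Delta> (15 / 16) k"
proof
  note iff = ring_of_integers_iq_iff[OF d]
  fix b assume b: "b \<in> ring_of_integers_iq d"
  then obtain s t :: int where st: "4 dvd s\<^sup>2 + int d * t\<^sup>2"
    "b = Complex (of_int s / 2) (of_int t * sqrt d / 2)"
    unfolding iff by blast
  {
    obtain N where N: "s\<^sup>2 + int d * t\<^sup>2 = 4 * N" using st by blast
    have "(cmod b)\<^sup>2 = of_int (s\<^sup>2 + int d * t\<^sup>2) / 4"
      by (simp add: st(2) cmod_power2 power_mult_distrib power_divide add_divide_distrib mult_ac)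
    then show "(cmod b)\<^sup>2 \<in> \<int>" by (simp add: N)
  }
  have "- b = Complex (of_int (- s) / 2) (of_int (- t) * sqrt d / 2)"
    by (simp add: st complex_eq_iff)
  moreover have "4 dvd (- s)\<^sup>2 + int d * (- t)\<^sup>2" using st by simp
  ultimately show "- b \<in> ring_of_integers_iq d" unfolding iff by blast
  show "(cmod b)\<^sup>2 \<noteq> of_int \<Delta>"
    using nn b complex_norm_square[of b] by (metis of_real_of_int_eq)
  fix l assume "l \<in> ring_of_integers_iq d"
  then obtain s' t' :: int where st': "4 dvd s'\<^sup>2 + int d * t'\<^sup>2"
    "l = Complex (of_int s' / 2) (of_int t' * sqrt d / 2)"
    unfolding iff by blast
  obtain M where M: "s * s' - int d * (t * t') = 2 * M"
    using dvd_4_imp_even[OF st(1) st'(1)] by blast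
  have "2 * Re (b * l) = of_int (s * s' - int d * (t * t')) / 2"
    by (simp add: st(2) st'(2) field_simps)
  then show "2 * Re (b * l) \<in> \<int>" by (simp add: M)
  fix a :: int
  \<comment> \<open>The cross term is 2 a times the even number \<open>2 * M\<close>, so all three
    summands are divisible by 4.\<close>
  have "(s + a * s')\<^sup>2 + int d * (t - a * t')\<^sup>2
      = (s\<^sup>2 + int d * t\<^sup>2) + a\<^sup>2 * (s'\<^sup>2 + int d * t'\<^sup>2) + 2 * a * (s * s' - int d * (t * t'))"
    by (simp add: power2_eq_square algebra_simps)
  also have "4 dvd \<dots>"
    unfolding M by (rule dvd_add[OF dvd_add[OF st(1) dvd_mult[OF st'(1)]]]) simp
  finally have "4 dvd (s + a * s')\<^sup>2 + int d * (t - a * t')\<^sup>2" .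
  moreover have "b + of_int a * cnj l = Complex (of_int (s + a * s') / 2) (of_int (t - a * t') * sqrt d / 2)"
    by (simp add: st(2) st'(2) complex_eq_iff field_simps)
  ultimately show "b + of_int a * cnj l \<in> ring_of_integers_iq d"
    unfolding iff by blast
next
  show "1 \<in> ring_of_integers_iq d"
    unfolding ring_of_integers_iq_iff[OF d]
    by (intro exI[of _ 2] exI[of _ 0]) (simp add: complex_eq_iff)
qed (use assms norm_euclidean_ring_of_integers_iq[OF d] in auto)

theorem theorem1p3:
  fixes d :: nat and \<Delta> :: int and k :: nat
  assumes "d \<in> {1, 2, 3, 7, 11}"
    and "\<Delta> > 0"
    and "\<not> (\<exists>\<beta>\<in>ring_of_integers_iq d. \<beta> * cnj \<beta> = of_int \<Delta>)"
    and "odd k"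
  defines "S \<equiv> {(a :: int, b :: complex, c :: int).
                  b \<in> ring_of_integers_iq d \<and> b * cnj b - of_int a * of_int c = of_int \<Delta> \<and> a < 0}"
    and "hterm \<equiv> \<lambda>z::complex. \<lambda>(a :: int, b :: complex, c :: int).
           max 0 ((Re (of_int a * of_real ((cmod z)\<^sup>2) + b * z + cnj b * cnj z + of_int c)) ^ k)"
  shows "(\<forall>z. hterm z summable_on S) \<and> continuous_on UNIV (\<lambda>z. \<Sum>\<^sub>\<infinity>t\<in>S. hterm z t)"
proof -
  interpret norm_euclidean_forms "ring_of_integers_iq d" \<Delta> "15 / 16" k
    using assms(1-4) by (rule norm_euclidean_forms_ring_of_integers_iq)
  \<comment> \<open>Both sides of the complex equation in \<open>S\<close> are real, so it is the
    real equation that defines \<open>forms\<close>.\<close>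
  have "b * cnj b - of_int a * of_int c = of_int \<Delta> \<longleftrightarrow> (cmod b)\<^sup>2 - of_int a * of_int c = of_int \<Delta>"
    for a c :: int and b
  proof -
    have "b * cnj b - of_int a * of_int c = of_real ((cmod b)\<^sup>2 - of_int a * of_int c)"
      by (simp add: complex_norm_square[symmetric])
    then show ?thesis
      by (metis of_real_eq_iff of_real_of_int_eq)
  qed
  then have "S = neg_forms"
    by (auto simp: S_def neg_forms_def forms_def)
  moreover have "hterm z t = form_term z t" for z t
    by (cases t) (simp add: hterm_def form_term_def algebra_simps)
  then have "hterm = form_term" by blast
  ultimately show ?thesis
    using summable_form_term continuous_form_sum by (simp add: form_sum_def[abs_def])
qed

end
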